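(* Let $(G,\cdot,\rhd,\Phi)$ be a twisted post-group with sub-adjacent operation $\circ$. Then: (1) For any $a,b\in G$, the map $\pi_{a,b}:(G_a,\circ)\to(G_b,\circ)$ given by $\pi_{a,b}(t)=t\circ e_b$ for all $t\in G_a$ is a group isomorphism. (2) $G=\bigsqcup G_a$, that is, $G$ is the disjoint union of the groups $G_a$, $a\in G$ (the sets $G_a$ cover $G$, and any two of them are either equal or disjoint).
   Context: A (left) twisted post-group $(G,\cdot,\rhd,\Phi)$ is a group $(G,\cdot)$ with maps $\rhd:G\times G\to G$ and $\Phi:G\to G$ such that, setting $a\circ b=\Phi(a)\cdot(a\rhd b)$ (the sub-adjacent operation), for all $a,b,c\in G$: (1) $L_a^{\rhd}:G\to G$, $L_a^{\rhd}(b)=a\rhd b$, is a group automorphism of $(G,\cdot)$; (2) $(a\circ b)\rhd c=a\rhd(b\rhd c)$; (3) $\Phi(a\circ b)=a\circ\Phi(b)$. For $a\in G$ put $e_a=(L_a^{\rhd})^{-1}(\Phi(a)^{-1}\cdot a)$ (inverse of $\Phi(a)$ taken in $(G,\cdot)$) and $G_a=\{b\circ e_a\mid b\in G\}$. Each $(G_a,\circ)$ is a group with identity element $e_a$. *)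

theory Defs
  imports "HOL-Algebra.Group"
begin

definition sub_adjacent ::
  "('a, 'm) monoid_scheme \<Rightarrow> ('a \<Rightarrow> 'a \<Rightarrow> 'a) \<Rightarrow> ('a \<Rightarrow> 'a) \<Rightarrow> 'a \<Rightarrow> 'a \<Rightarrow> 'a"
  where "sub_adjacent G rhd \<Phi> a b = \<Phi> a \<otimes>\<^bsub>G\<^esub> rhd a b"

(* rhd and \<Phi> are total on the type, but all axioms constrain them on the carrier only.
   Closure of the carrier under rhd is part of rhd_auto. *)
locale twisted_post_group = group G
  for G :: "('a, 'm) monoid_scheme" (structure) +
  fixes rhd :: "'a \<Rightarrow> 'a \<Rightarrow> 'a"  (infixr "\<rhd>" 75)
    and \<Phi> :: "'a \<Rightarrow> 'a"
  assumes Phi_closed: "\<Phi> \<in> carrier G \<rightarrow> carrier G"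
    and rhd_auto: "a \<in> carrier G \<Longrightarrow> (\<lambda>b. a \<rhd> b) \<in> iso G G"
    and sub_adjacent_rhd:
      "\<lbrakk>a \<in> carrier G; b \<in> carrier G; c \<in> carrier G\<rbrakk>
        \<Longrightarrow> sub_adjacent G (\<rhd>) \<Phi> a b \<rhd> c = a \<rhd> (b \<rhd> c)"
    and Phi_sub_adjacent:
      "\<lbrakk>a \<in> carrier G; b \<in> carrier G\<rbrakk>
        \<Longrightarrow> \<Phi> (sub_adjacent G (\<rhd>) \<Phi> a b) = sub_adjacent G (\<rhd>) \<Phi> a (\<Phi> b)"

definition local_unit ::
  "('a, 'm) monoid_scheme \<Rightarrow> ('a \<Rightarrow> 'a \<Rightarrow> 'a) \<Rightarrow> ('a \<Rightarrow> 'a) \<Rightarrow> 'a \<Rightarrow> 'a"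
  where "local_unit G rhd \<Phi> a =
    inv_into (carrier G) (\<lambda>b. rhd a b) (inv\<^bsub>G\<^esub> (\<Phi> a) \<otimes>\<^bsub>G\<^esub> a)"

definition local_group ::
  "('a, 'm) monoid_scheme \<Rightarrow> ('a \<Rightarrow> 'a \<Rightarrow> 'a) \<Rightarrow> ('a \<Rightarrow> 'a) \<Rightarrow> 'a \<Rightarrow> 'a monoid"
  where "local_group G rhd \<Phi> a =
    \<lparr>carrier = {sub_adjacent G rhd \<Phi> b (local_unit G rhd \<Phi> a) | b. b \<in> carrier G},
     mult = sub_adjacent G rhd \<Phi>,
     one = local_unit G rhd \<Phi> a\<rparr>"

definition local_map ::
  "('a, 'm) monoid_scheme \<Rightarrow> ('a \<Rightarrow> 'a \<Rightarrow> 'a) \<Rightarrow> ('a \<Rightarrow> 'a) \<Rightarrow> 'a \<Rightarrow> 'a \<Rightarrow> 'a"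
  where "local_map G rhd \<Phi> b t = sub_adjacent G rhd \<Phi> t (local_unit G rhd \<Phi> b)"

end

theory Submission
  imports Defs
begin

text \<open>
  The sub-adjacent operation turns \<open>G\<close> into a right group, that is, a semigroup in which every
  equation \<open>a \<star> x = b\<close> has exactly one solution \<open>x\<close>; the theorem then follows from the classical
  structure theory of right groups. Associativity comes from the compatibility of \<open>\<Phi>\<close> and \<open>\<rhd>\<close>
  with the sub-adjacent operation (lemma \<open>sub_adjacent_assoc\<close>). Unique solvability holds because
  left translation by \<open>a\<close> is the automorphism \<open>b \<mapsto> a \<rhd> b\<close> followed by left multiplication by
  \<open>\<Phi> a\<close> in the group \<open>G\<close>, hence a bijection (lemma \<open>sub_adjacent_solvable\<close>). The local unit
  \<open>e\<^sub>a\<close> is simply the solution of \<open>a \<star> x = a\<close>.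

  In a right group, left cancellation forces every right unit \<open>e\<close> of some element to be idempotent,
  and every idempotent to be a left identity of the whole semigroup. So the elements fixed by right
  multiplication with \<open>e\<close> form a group with identity \<open>e\<close>. Two idempotents \<open>d\<close>, \<open>e\<close> satisfy
  \<open>d \<star> e = e\<close>, which makes the right translations by \<open>d\<close> and \<open>e\<close> mutually inverse between
  their groups. A common element of the two groups has both \<open>d\<close> and \<open>e\<close> as right unit, and right
  units are unique, so the groups are equal or disjoint. Every \<open>a\<close> lies in the group of its own
  right unit.
\<close>

locale right_group =
  fixes S :: "'a set" and mul :: "'a \<Rightarrow> 'a \<Rightarrow> 'a"  (infixl "\<star>" 70)
  assumes closed: "\<lbrakk>a \<in> S; b \<in> S\<rbrakk> \<Longrightarrow> a \<star> b \<in> S"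
    and assoc: "\<lbrakk>a \<in> S; b \<in> S; c \<in> S\<rbrakk> \<Longrightarrow> a \<star> b \<star> c = a \<star> (b \<star> c)"
    and solvable: "\<lbrakk>a \<in> S; b \<in> S\<rbrakk> \<Longrightarrow> \<exists>!x. x \<in> S \<and> a \<star> x = b"
begin

lemma left_cancel: "\<lbrakk>a \<in> S; x \<in> S; y \<in> S; a \<star> x = a \<star> y\<rbrakk> \<Longrightarrow> x = y"
  using solvable[of a "a \<star> x"] closed by metis

text \<open>Cancel \<open>a\<close> in \<open>a \<star> e \<star> e = a \<star> e\<close>.\<close>

lemma right_unit_idem:
  assumes "a \<in> S" "e \<in> S" "a \<star> e = a"
  shows "e \<star> e = e"
proof (rule left_cancel[of a])
  show "a \<star> (e \<star> e) = a \<star> e"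
    using assms by (simp flip: assoc)
qed (use assms closed in auto)

text \<open>Cancel \<open>e\<close> in \<open>e \<star> e \<star> x = e \<star> x\<close>.\<close>

lemma idem_left_identity:
  assumes "e \<in> S" "e \<star> e = e" "x \<in> S"
  shows "e \<star> x = x"
proof (rule left_cancel[of e])
  show "e \<star> (e \<star> x) = e \<star> x"
    using assms by (simp flip: assoc)
qed (use assms closed in auto)

definition idem_group :: "'a \<Rightarrow> 'a monoid"
  where "idem_group e = \<lparr>carrier = {b \<star> e | b. b \<in> S}, mult = (\<star>), one = e\<rparr>"

lemma idem_group_simps [simp]:
  "mult (idem_group e) = (\<star>)" "one (idem_group e) = e"
  by (simp_all add: idem_group_def)

lemma mem_idem_group_iff:
  assumes "e \<in> S" "e \<star> e = e"
  shows "x \<in> carrier (idem_group e) \<longleftrightarrow> x \<in> S \<and> x \<star> e = x"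
proof
  assume "x \<in> carrier (idem_group e)"
  then obtain b where "b \<in> S" "x = b \<star> e"
    by (auto simp: idem_group_def)
  then show "x \<in> S \<and> x \<star> e = x"
    using assms closed assoc by simp
next
  assume "x \<in> S \<and> x \<star> e = x"
  then show "x \<in> carrier (idem_group e)"
    by (force simp: idem_group_def)
qed

text \<open>
  Solving \<open>x \<star> s = e\<close> gives a right inverse \<open>s\<close>; it is also a left inverse, because
  \<open>x \<star> (s \<star> x) = e \<star> x = x = x \<star> e\<close> and \<open>x\<close> can be cancelled. The translate \<open>s \<star> e\<close>
  is the candidate that lies in the group.
\<close>

lemma group_idem_group:
  assumes e: "e \<in> S" "e \<star> e = e"
  shows "group (idem_group e)"
proof (rule groupI)
  fix x y assume "x \<in> carrier (idem_group e)" "y \<in> carrier (idem_group e)"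
  then show "x \<otimes>\<^bsub>idem_group e\<^esub> y \<in> carrier (idem_group e)"
    using e by (simp add: mem_idem_group_iff closed assoc)
next
  fix x assume "x \<in> carrier (idem_group e)"
  then have x: "x \<in> S" "x \<star> e = x"
    using e by (simp_all add: mem_idem_group_iff)
  obtain s where s: "s \<in> S" "x \<star> s = e"
    using solvable[OF x(1) e(1)] by blast
  have "s \<star> x = e"
  proof (rule left_cancel[of x])
    have "x \<star> (s \<star> x) = x \<star> s \<star> x"
      using x s assoc[of x s x] by simp
    also have "\<dots> = x \<star> e"
      using x s e by (simp add: idem_left_identity)
    finally show "x \<star> (s \<star> x) = x \<star> e" .
  qed (use x s e closed in auto)
  then have "s \<star> e \<star> x = e"
    using x s e by (simp add: assoc idem_left_identity)
  moreover have "s \<star> e \<in> carrier (idem_group e)"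
    using s by (auto simp: idem_group_def)
  ultimately show "\<exists>y\<in>carrier (idem_group e). y \<otimes>\<^bsub>idem_group e\<^esub> x = \<one>\<^bsub>idem_group e\<^esub>"
    by auto
qed (use e in \<open>auto simp: mem_idem_group_iff assoc idem_left_identity\<close>)

text \<open>
  Right translation by \<open>e\<close> is multiplicative since \<open>x \<star> e \<star> (y \<star> e) = x \<star> y \<star> e\<close> by the left identity
  property of \<open>e\<close>; its inverse is translation by \<open>d\<close>, since \<open>x \<star> e \<star> d = x \<star> d = x\<close> for \<open>x\<close> in
  the group of \<open>d\<close>.
\<close>

lemma translation_iso:
  assumes d: "d \<in> S" "d \<star> d = d" and e: "e \<in> S" "e \<star> e = e"
  shows "(\<lambda>t. t \<star> e) \<in> iso (idem_group d) (idem_group e)"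
proof (rule isoI)
  show "(\<lambda>t. t \<star> e) \<in> hom (idem_group d) (idem_group e)"
    using d e by (auto simp: hom_def mem_idem_group_iff closed assoc idem_left_identity)
  show "bij_betw (\<lambda>t. t \<star> e) (carrier (idem_group d)) (carrier (idem_group e))"
    by (rule bij_betwI[where g = "\<lambda>t. t \<star> d"])
      (use d e in \<open>auto simp: mem_idem_group_iff closed assoc idem_left_identity\<close>)
qed

lemma idem_groups_eq_or_disjoint:
  assumes "d \<in> S" "d \<star> d = d" "e \<in> S" "e \<star> e = e"
  shows "carrier (idem_group d) = carrier (idem_group e) \<or>
    carrier (idem_group d) \<inter> carrier (idem_group e) = {}"
proof -
  have "d = e" if "x \<in> carrier (idem_group d)" "x \<in> carrier (idem_group e)" for x
    using that assms left_cancel[of x d e] by (simp add: mem_idem_group_iff)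
  then show ?thesis by blast
qed

end

context twisted_post_group
begin

abbreviation sub_adjacent_op (infixl "\<star>" 70)
  where "a \<star> b \<equiv> sub_adjacent G (\<rhd>) \<Phi> a b"

lemma Phi_in_carrier: "a \<in> carrier G \<Longrightarrow> \<Phi> a \<in> carrier G"
  using Phi_closed by blast

lemma rhd_in_carrier: "\<lbrakk>a \<in> carrier G; b \<in> carrier G\<rbrakk> \<Longrightarrow> a \<rhd> b \<in> carrier G"
  using rhd_auto[of a] by (auto simp: iso_def hom_def)

lemma rhd_mult:
  "\<lbrakk>a \<in> carrier G; b \<in> carrier G; c \<in> carrier G\<rbrakk> \<Longrightarrow> a \<rhd> (b \<otimes> c) = (a \<rhd> b) \<otimes> (a \<rhd> c)"
  using rhd_auto[of a] by (auto simp: iso_def hom_def)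

lemma rhd_bij: "a \<in> carrier G \<Longrightarrow> bij_betw (\<lambda>b. a \<rhd> b) (carrier G) (carrier G)"
  using rhd_auto[of a] by (auto simp: iso_def)

lemma sub_adjacent_closed: "\<lbrakk>a \<in> carrier G; b \<in> carrier G\<rbrakk> \<Longrightarrow> a \<star> b \<in> carrier G"
  by (simp add: sub_adjacent_def Phi_in_carrier rhd_in_carrier)

text \<open>
  Both sides equal \<open>\<Phi> a \<otimes> (a \<rhd> \<Phi> b) \<otimes> (a \<rhd> (b \<rhd> c))\<close>: on the left by the two compatibility
  axioms, on the right because \<open>\<rhd>\<close> acts by endomorphisms.
\<close>

lemma sub_adjacent_assoc:
  assumes "a \<in> carrier G" "b \<in> carrier G" "c \<in> carrier G"
  shows "a \<star> b \<star> c = a \<star> (b \<star> c)"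
proof -
  have "a \<star> b \<star> c = \<Phi> (a \<star> b) \<otimes> ((a \<star> b) \<rhd> c)"
    by (rule sub_adjacent_def)
  also have "\<dots> = (a \<star> \<Phi> b) \<otimes> (a \<rhd> (b \<rhd> c))"
    using assms by (simp add: Phi_sub_adjacent sub_adjacent_rhd)
  also have "\<dots> = a \<star> (b \<star> c)"
    using assms by (simp add: sub_adjacent_def Phi_in_carrier rhd_in_carrier rhd_mult m_assoc)
  finally show ?thesis .
qed

lemma sub_adjacent_eq_iff:
  assumes "a \<in> carrier G" "b \<in> carrier G" "x \<in> carrier G"
  shows "a \<star> x = b \<longleftrightarrow> a \<rhd> x = inv (\<Phi> a) \<otimes> b"
  using assms inv_solve_left[of "a \<rhd> x" "\<Phi> a" b]
  by (auto simp: sub_adjacent_def Phi_in_carrier rhd_in_carrier)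

lemma sub_adjacent_solvable:
  assumes "a \<in> carrier G" "b \<in> carrier G"
  shows "\<exists>!x. x \<in> carrier G \<and> a \<star> x = b"
proof -
  have "inv (\<Phi> a) \<otimes> b \<in> carrier G"
    using assms by (simp add: Phi_in_carrier)
  then obtain x where "x \<in> carrier G" "a \<rhd> x = inv (\<Phi> a) \<otimes> b"
    using bij_betw_imp_surj_on[OF rhd_bij[OF assms(1)]] by (metis imageE)
  then have "\<exists>!x. x \<in> carrier G \<and> a \<rhd> x = inv (\<Phi> a) \<otimes> b"
    using inj_onD[OF bij_betw_imp_inj_on[OF rhd_bij[OF assms(1)]]] by auto
  then show ?thesis
    using assms by (simp add: sub_adjacent_eq_iff cong: conj_cong)
qed

sublocale sub_adjacent: right_group "carrier G" "sub_adjacent G (\<rhd>) \<Phi>"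
  by unfold_locales (simp_all add: sub_adjacent_closed sub_adjacent_assoc sub_adjacent_solvable)

lemma local_unit:
  assumes "a \<in> carrier G"
  shows "local_unit G (\<rhd>) \<Phi> a \<in> carrier G" "a \<star> local_unit G (\<rhd>) \<Phi> a = a"
proof -
  have image: "inv (\<Phi> a) \<otimes> a \<in> (\<lambda>b. a \<rhd> b) ` carrier G"
    using rhd_bij[OF assms] assms by (simp add: bij_betw_def Phi_in_carrier)
  show closed: "local_unit G (\<rhd>) \<Phi> a \<in> carrier G"
    unfolding local_unit_def using image by (rule inv_into_into)
  have "a \<rhd> local_unit G (\<rhd>) \<Phi> a = inv (\<Phi> a) \<otimes> a"
    unfolding local_unit_def using image by (rule f_inv_into_f)
  then show "a \<star> local_unit G (\<rhd>) \<Phi> a = a"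
    using assms closed by (simp add: sub_adjacent_eq_iff)
qed

lemma local_unit_idem:
  "a \<in> carrier G \<Longrightarrow> local_unit G (\<rhd>) \<Phi> a \<star> local_unit G (\<rhd>) \<Phi> a = local_unit G (\<rhd>) \<Phi> a"
  using local_unit sub_adjacent.right_unit_idem by blast

lemma local_group_eq_idem_group:
  "local_group G (\<rhd>) \<Phi> a = sub_adjacent.idem_group (local_unit G (\<rhd>) \<Phi> a)"
  by (simp add: local_group_def sub_adjacent.idem_group_def)

lemma local_map_eq_translation:
  "local_map G (\<rhd>) \<Phi> b = (\<lambda>t. t \<star> local_unit G (\<rhd>) \<Phi> b)"
  by (simp add: local_map_def fun_eq_iff)

lemma carrier_eq_Union_local_groups:
  "carrier G = (\<Union>a\<in>carrier G. carrier (local_group G (\<rhd>) \<Phi> a))"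
  by (auto simp: local_group_eq_idem_group sub_adjacent.mem_idem_group_iff local_unit
      local_unit_idem)

end

theorem theorem3p4:
  fixes G :: "('a, 'm) monoid_scheme"
    and rhd :: "'a \<Rightarrow> 'a \<Rightarrow> 'a"
    and \<Phi> :: "'a \<Rightarrow> 'a"
  assumes "twisted_post_group G rhd \<Phi>"
  shows "(\<forall>a\<in>carrier G. \<forall>b\<in>carrier G.
            group (local_group G rhd \<Phi> a) \<and> group (local_group G rhd \<Phi> b) \<and>
            local_map G rhd \<Phi> b \<in> iso (local_group G rhd \<Phi> a) (local_group G rhd \<Phi> b))
       \<and> carrier G = (\<Union>a\<in>carrier G. carrier (local_group G rhd \<Phi> a))
       \<and> (\<forall>a\<in>carrier G. \<forall>b\<in>carrier G.
            carrier (local_group G rhd \<Phi> a) = carrier (local_group G rhd \<Phi> b) \<or>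
            carrier (local_group G rhd \<Phi> a) \<inter> carrier (local_group G rhd \<Phi> b) = {})"
proof -
  interpret twisted_post_group G rhd \<Phi> by (rule assms)
  note units = local_unit(1) local_unit_idem
  show ?thesis
  proof (intro conjI ballI)
    show "carrier G = (\<Union>a\<in>carrier G. carrier (local_group G rhd \<Phi> a))"
      by (rule carrier_eq_Union_local_groups)
  qed (simp_all add: local_group_eq_idem_group local_map_eq_translation units
      sub_adjacent.group_idem_group sub_adjacent.translation_iso
      sub_adjacent.idem_groups_eq_or_disjoint)
qed

end
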